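(* (Bounding Box Theorem) Let $\alpha\in(0,1]$. For every period $P$ of a loop level set in $S(G_\alpha)$, with $\rho=P/2$, let $\Lambda_P(t)=(a(t),b(t),0)$, $t\in(0,\rho]$, be the associated plane curve, and let $B_P$ be the rectangle in the $XY$ plane with vertices $(0,0,0)$, $(0,b(\rho),0)$, $(a(\rho),0,0)$, $(a(\rho),b(\rho),0)$. Then $\Lambda_P(t)$ lies in the interior of $B_P$ (relative to the $XY$ plane) for all $t\in(0,\rho)$.
   Context: $G_\alpha$ is $\mathbb{R}^3$ with group law $(x,y,z)\ast(x',y',z')=(x'e^z+x,\;y'e^{-\alpha z}+y,\;z'+z)$ and left-invariant metric $ds^2=e^{-2z}dx^2+e^{2\alpha z}dy^2+dz^2$. Its Lie algebra is identified with $\mathbb{R}^3$ via the orthonormal left-invariant frame $X=e^z\partial_x$, $Y=e^{-\alpha z}\partial_y$, $Z=\partial_z$, and $E$ is the Riemannian exponential map at the identity $(0,0,0)$. For a unit-speed geodesic $\gamma$, the coordinates of $\gamma'$ in this frame trace an integral curve, on the unit sphere $S(G_\alpha)$, of $\Sigma_\alpha(x,y,z)=(xz,-\alpha yz,\alpha y^2-x^2)$. In the sector $x,y>0$ of the sphere the non-equilibrium integral curves are closed curves, the loop level sets (level sets of $|x|^\alpha y$); the period $P$ of a loop level set is the time the flow takes to go once around. Fix the loop level set in the sector $x,y>0$ of period $P$ and put $\rho=P/2$. It meets the plane $z=0$ in two points; let $p_0=(x(0),y(0),0)$ be the one with $x(0)\in\big(\sqrt{\alpha/(1+\alpha)},1\big)$.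 Let $p_t=(x(t),y(t),z(t))$ be the point reached from $p_0$ after time $t$ by flowing backwards, i.e. $(x',y',z')=(-xz,\alpha yz,x^2-\alpha y^2)$; for $t\in(0,\rho)$ one has $z(t)>0$. Let $V_t=2t\,p_t$: the corresponding geodesic segment has length $2t$, initial direction $p_t$ and final direction $(x(t),y(t),-z(t))$. Its endpoint $E(V_t)$ lies in the plane $z=0$, and $\Lambda_P(t):=E(V_t)=(a(t),b(t),0)$ for $t\in(0,\rho]$. Equivalently, $a'=2x+az$, $b'=2y-\alpha bz$ with $a(0)=b(0)=0$. *)

theory Defs
  imports "HOL-Analysis.Analysis"
begin

text \<open>A metric is given by its Gram matrix in the coordinates of a single global chart.\<close>

definition partial_deriv :: "'n::finite \<Rightarrow> (real^'n \<Rightarrow> real) \<Rightarrow> real^'n \<Rightarrow> real" where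
  "partial_deriv i f p = frechet_derivative f (at p) (axis i 1)"

definition christoffel ::
    "(real^'n \<Rightarrow> real^'n^'n) \<Rightarrow> real^'n \<Rightarrow> 'n::finite \<Rightarrow> 'n \<Rightarrow> 'n \<Rightarrow> real" where
  "christoffel g p k i j =
     (1/2) * (\<Sum>l\<in>UNIV. matrix_inv (g p) $ k $ l *
        (partial_deriv i (\<lambda>q. g q $ j $ l) p + partial_deriv j (\<lambda>q. g q $ i $ l) p
          - partial_deriv l (\<lambda>q. g q $ i $ j) p))"

definition geodesic_on ::
    "(real^'n \<Rightarrow> real^'n^'n) \<Rightarrow> real set \<Rightarrow> (real \<Rightarrow> real^'n::finite) \<Rightarrow> bool" where
  "geodesic_on g S \<gamma> \<longleftrightarrow>
     (\<exists>v. \<forall>t\<in>S. (\<gamma> has_vector_derivative v t) (at t within S) \<and>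
        (v has_vector_derivative
          (\<chi> k. - (\<Sum>i\<in>UNIV. \<Sum>j\<in>UNIV. christoffel g (\<gamma> t) k i j * v t $ i * v t $ j)))
          (at t within S))"

definition riemannian_exp ::
    "(real^'n \<Rightarrow> real^'n^'n) \<Rightarrow> real^'n \<Rightarrow> real^'n \<Rightarrow> real^'n::finite" where
  "riemannian_exp g p w =
     (THE q. \<exists>\<gamma>. geodesic_on g {0..1} \<gamma> \<and> \<gamma> 0 = p \<and>
        (\<gamma> has_vector_derivative w) (at 0 within {0..1}) \<and> \<gamma> 1 = q)"

text \<open>The left-invariant metric
  \<open>ds\<^sup>2 = e\<^bsup>-2z\<^esup> dx\<^sup>2 + e\<^bsup>2\<alpha>z\<^esup> dy\<^sup>2 + dz\<^sup>2\<close> of the group law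
  \<open>(x,y,z) * (x',y',z') = (x' e\<^bsup>z\<^esup> + x, y' e\<^bsup>-\<alpha>z\<^esup> + y, z' + z)\<close>, whose identity is \<open>0\<close>.\<close>

definition G_metric :: "real \<Rightarrow> real^3 \<Rightarrow> real^3^3" where
  "G_metric \<alpha> p = vector [vector [exp (- 2 * p$3), 0, 0],
                           vector [0, exp (2 * \<alpha> * p$3), 0],
                           vector [0, 0, 1]]"

text \<open>The tangent vector at \<open>p\<close> with coordinates \<open>V\<close> in the orthonormal left-invariant frame
  \<open>X = e\<^bsup>z\<^esup> \<partial>\<^sub>x\<close>, \<open>Y = e\<^bsup>-\<alpha>z\<^esup> \<partial>\<^sub>y\<close>, \<open>Z = \<partial>\<^sub>z\<close>.\<close>

definition G_frame :: "real \<Rightarrow> real^3 \<Rightarrow> real^3 \<Rightarrow> real^3" where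
  "G_frame \<alpha> p V = vector [exp (p$3) * V$1, exp (- \<alpha> * p$3) * V$2, V$3]"

definition G_exp :: "real \<Rightarrow> real^3 \<Rightarrow> real^3" where
  "G_exp \<alpha> V = riemannian_exp (G_metric \<alpha>) 0 (G_frame \<alpha> 0 V)"

definition Sigma_field :: "real \<Rightarrow> real^3 \<Rightarrow> real^3" where
  "Sigma_field \<alpha> p = vector [p$1 * p$3, - \<alpha> * p$2 * p$3, \<alpha> * (p$2)\<^sup>2 - (p$1)\<^sup>2]"

definition integral_curve :: "(real^'n \<Rightarrow> real^'n) \<Rightarrow> (real \<Rightarrow> real^'n::finite) \<Rightarrow> bool" where
  "integral_curve F \<gamma> \<longleftrightarrow> (\<forall>t. (\<gamma> has_vector_derivative F (\<gamma> t)) (at t))"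

text \<open>Equilibria are excluded: the maximal level set of \<open>\<bar>x\<bar>\<^sup>\<alpha> y\<close> in the sector is a single
  zero of the field.\<close>

definition loop_level_set :: "real \<Rightarrow> (real^3) set \<Rightarrow> bool" where
  "loop_level_set \<alpha> L \<longleftrightarrow>
     (\<exists>c. L = {p \<in> sphere 0 1. p$1 > 0 \<and> p$2 > 0 \<and> \<bar>p$1\<bar> powr \<alpha> * p$2 = c}) \<and>
     L \<noteq> {} \<and> (\<forall>p\<in>L. Sigma_field \<alpha> p \<noteq> 0)"

definition loop_period :: "real \<Rightarrow> (real^3) set \<Rightarrow> real \<Rightarrow> bool" where
  "loop_period \<alpha> L P \<longleftrightarrow> P > 0 \<and>
     (\<exists>\<gamma>. integral_curve (Sigma_field \<alpha>) \<gamma> \<and> \<gamma> P = \<gamma> 0 \<and>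
        inj_on \<gamma> {0..<P} \<and> \<gamma> ` {0..<P} = L)"

definition loop_start :: "real \<Rightarrow> (real^3) set \<Rightarrow> real^3 \<Rightarrow> bool" where
  "loop_start \<alpha> L p\<^sub>0 \<longleftrightarrow>
     p\<^sub>0 \<in> L \<and> p\<^sub>0$3 = 0 \<and> p\<^sub>0$1 \<in> {sqrt (\<alpha> / (1 + \<alpha>))<..<1}"

text \<open>For \<open>p\<close> the backward flow line of \<open>\<Sigma>\<^sub>\<alpha>\<close> from the starting point, \<open>Lambda \<alpha> p t\<close> is the
  endpoint of the geodesic segment of length \<open>2t\<close> with initial direction \<open>p t\<close>.\<close>

definition Lambda :: "real \<Rightarrow> (real \<Rightarrow> real^3) \<Rightarrow> real \<Rightarrow> real^3" where
  "Lambda \<alpha> p t = G_exp \<alpha> ((2 * t) *\<^sub>R p t)"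

definition XY_plane :: "(real^3) set" where
  "XY_plane = {q. q$3 = 0}"

definition bounding_box :: "real \<Rightarrow> real \<Rightarrow> (real^3) set" where
  "bounding_box a b =
     convex hull {vector [0, 0, 0], vector [0, b, 0], vector [a, 0, 0], vector [a, b, 0]}"

end

(* Write x' = -xz, y' = alpha yz, z' = x^2 - alpha y^2 for the backward flow, and let A, B be the
   integrals of x^2, y^2 from 0. Since x and y are exponentials of the integral of z, and the flow
   is symmetric under (t, z) -> (-t, -z), the geodesic equations integrate to a = 2A/x, b = 2B/y,
   with A - alpha B = z. As z > 0 on (0, rho), a is increasing, and b' > 0 amounts to
   alpha z B < y^2. This follows from z A <= x(0)^2 - x^2: the function (x(0)^2 - x^2)/z - A tends
   to 0 at 0, and it is nondecreasing because, with zeta the integral of z,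
   alpha (exp (2 zeta) - 1) >= 1 - exp (-2 alpha zeta). Hence both coordinates of Lambda_P are
   positive and strictly increasing up to time rho. *)

theory Submission imports Defs begin

section \<open>Componentwise derivatives and a Gronwall estimate\<close>

lemma has_vector_derivative_vec_iff:
  fixes f :: "real \<Rightarrow> real^'n"
  shows "(f has_vector_derivative f') (at t within S) \<longleftrightarrow>
    (\<forall>i. ((\<lambda>s. f s $ i) has_real_derivative f' $ i) (at t within S))"
  unfolding has_vector_derivative_def has_field_derivative_def
    has_derivative_componentwise_within[of f]
  by (auto simp: Basis_vec_def inner_axis mult.commute[where b = "f' $ _"])

text \<open>The product \<open>exp (- K * s) * w s\<close> is nonincreasing and starts at 0, which
  forces \<open>w t\<close> to be at most 0. It serves for uniqueness of flow lines, with
  \<open>w\<close> the squared distance of two solutions.\<close>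

lemma gronwall_zero:
  fixes w w' :: "real \<Rightarrow> real"
  assumes deriv: "\<And>s. s \<in> {0..T} \<Longrightarrow> (w has_real_derivative w' s) (at s within {0..T})"
    and bound: "\<And>s. s \<in> {0..T} \<Longrightarrow> w' s \<le> K * w s"
    and "w 0 = 0" "w t \<ge> 0" "t \<in> {0..T}"
  shows "w t = 0"
proof -
  have "((\<lambda>s. exp (- K * s) * w s) has_real_derivative exp (- K * s) * (w' s - K * w s))
      (at s within {0..t})" if "s \<in> {0..t}" for s
    using DERIV_subset[OF deriv[of s], of "{0..t}"] that \<open>t \<in> {0..T}\<close>
    by (auto intro!: derivative_eq_intros simp: algebra_simps)
  note D = this
  have "exp (- K * t) * w t \<le> exp (- K * 0) * w 0"
  proof (rule DERIV_nonpos_imp_decreasing_open[where f = "\<lambda>s. exp (- K * s) * w s"])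
    show "continuous_on {0..t} (\<lambda>s. exp (- K * s) * w s)"
      by (rule DERIV_continuous_on[OF D])
    fix s assume s: "0 < s" "s < t"
    have "((\<lambda>s. exp (- K * s) * w s) has_real_derivative exp (- K * s) * (w' s - K * w s)) (at s)"
      using D[of s] s by (simp add: at_within_Icc_at)
    moreover have "exp (- K * s) * (w' s - K * w s) \<le> 0"
      using bound[of s] s \<open>t \<in> {0..T}\<close> by (simp add: mult_le_0_iff)
    ultimately show "\<exists>y. ((\<lambda>s. exp (- K * s) * w s) has_real_derivative y) (at s) \<and> y \<le> 0"
      by blast
  qed (use \<open>t \<in> {0..T}\<close> in auto)
  then show ?thesis
    using \<open>w 0 = 0\<close> \<open>w t \<ge> 0\<close> by (simp add: mult_le_0_iff)
qed

section \<open>The field \<open>Sigma_field\<close>: invariant spheres, a Lipschitz bound,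
  uniqueness of flow lines\<close>

lemma Sigma_field_nth [simp]:
  "Sigma_field \<alpha> p $ 1 = p$1 * p$3"
  "Sigma_field \<alpha> p $ 2 = - \<alpha> * p$2 * p$3"
  "Sigma_field \<alpha> p $ 3 = \<alpha> * (p$2)\<^sup>2 - (p$1)\<^sup>2"
  by (simp_all add: Sigma_field_def vector_3)

lemma inner_Sigma_field: "p \<bullet> Sigma_field \<alpha> p = 0"
  by (simp add: inner_vec_def sum_3 power2_eq_square algebra_simps)

text \<open>The field is quadratic, so the Lipschitz constant grows with the radius \<open>M\<close>
  of the ball.\<close>

lemma Sigma_field_lipschitz:
  assumes "norm u \<le> M" "norm v \<le> M"
  shows "norm (Sigma_field \<alpha> u - Sigma_field \<alpha> v) \<le> 4 * (1 + \<bar>\<alpha>\<bar>) * M * norm (u - v)"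
proof -
  define d where "d = u - v"
  have d: "\<bar>d $ i\<bar> \<le> norm d" for i by (rule component_le_norm_cart)
  have M: "\<bar>u $ i\<bar> \<le> M" "\<bar>v $ i\<bar> \<le> M" for i
    using component_le_norm_cart[of u i] component_le_norm_cart[of v i] assms by auto
  have prod: "\<bar>a * b\<bar> \<le> M * norm d" if "\<bar>a\<bar> \<le> norm d" "\<bar>b\<bar> \<le> M" for a b
    using mult_mono[OF that(2,1)] M(1)[of 1] by (simp add: abs_mult mult.commute)
  have "norm (Sigma_field \<alpha> u - Sigma_field \<alpha> v)
      \<le> (\<Sum>i\<in>UNIV. \<bar>(Sigma_field \<alpha> u - Sigma_field \<alpha> v) $ i\<bar>)"
    by (rule norm_le_l1_cart)
  \<comment> \<open>Each difference of quadratic monomials is split by changing one factor at a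
    time, which leaves terms with one factor from \<open>d\<close> and the other from
    \<open>u\<close> or \<open>v\<close>.\<close>
  also have "\<dots> = \<bar>d$1 * u$3 + d$3 * v$1\<bar> + \<bar>- \<alpha> * (d$2 * u$3 + d$3 * v$2)\<bar>
      + \<bar>\<alpha> * (d$2 * u$2 + d$2 * v$2) - (d$1 * u$1 + d$1 * v$1)\<bar>"
    by (simp add: sum_3 d_def power2_eq_square algebra_simps)
  also have "\<dots> \<le> (2 * (M * norm d)) + (\<bar>\<alpha>\<bar> * (2 * (M * norm d)))
      + (\<bar>\<alpha>\<bar> * (2 * (M * norm d)) + 2 * (M * norm d))"
  proof (intro add_mono)
    have t: "\<bar>a + b\<bar> \<le> 2 * (M * norm d)" if "\<bar>a\<bar> \<le> M * norm d" "\<bar>b\<bar> \<le> M * norm d" for a b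
      using that by linarith
    show "\<bar>d$1 * u$3 + d$3 * v$1\<bar> \<le> 2 * (M * norm d)"
      by (intro t prod d M)
    show "\<bar>- \<alpha> * (d$2 * u$3 + d$3 * v$2)\<bar> \<le> \<bar>\<alpha>\<bar> * (2 * (M * norm d))"
      unfolding abs_mult abs_minus_cancel by (intro mult_left_mono t prod d M) auto
    have "\<bar>\<alpha> * (d$2 * u$2 + d$2 * v$2)\<bar> \<le> \<bar>\<alpha>\<bar> * (2 * (M * norm d))"
      unfolding abs_mult by (intro mult_left_mono t prod d M) auto
    moreover have "\<bar>d$1 * u$1 + d$1 * v$1\<bar> \<le> 2 * (M * norm d)"
      by (intro t prod d M)
    ultimately show "\<bar>\<alpha> * (d$2 * u$2 + d$2 * v$2) - (d$1 * u$1 + d$1 * v$1)\<bar>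
        \<le> \<bar>\<alpha>\<bar> * (2 * (M * norm d)) + 2 * (M * norm d)"
      by linarith
  qed
  finally show ?thesis by (simp add: d_def algebra_simps)
qed

text \<open>The field is orthogonal to the position vector, so the squared norm has derivative 0.
  This confines solutions to a ball on which the Lipschitz bound applies.\<close>

lemma Sigma_flow_norm:
  assumes "\<And>s. s \<in> {0..T} \<Longrightarrow>
      (u has_vector_derivative c *\<^sub>R Sigma_field \<alpha> (u s)) (at s within {0..T})"
    and "t \<in> {0..T}"
  shows "norm (u t) = norm (u 0)"
proof -
  have "((\<lambda>s. u s \<bullet> u s) has_derivative (\<lambda>h. 0)) (at s within {0..T})" if "s \<in> {0..T}" for s
    using has_derivative_inner[OF assms(1)[OF that, unfolded has_vector_derivative_def]
        assms(1)[OF that, unfolded has_vector_derivative_def]]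
    by (simp add: inner_Sigma_field inner_commute)
  then obtain k where "\<And>s. s \<in> {0..T} \<Longrightarrow> u s \<bullet> u s = k"
    using has_derivative_zero_constant[of "{0..T}" "\<lambda>s. u s \<bullet> u s"] by auto
  then have "u t \<bullet> u t = u 0 \<bullet> u 0"
    using assms(2) by simp
  then show ?thesis by (simp add: norm_eq)
qed

text \<open>Gronwall applied to the squared distance. The factor \<open>c\<close> covers forward and
  backward flow at once.\<close>

lemma Sigma_flow_unique_on:
  assumes u: "\<And>s. s \<in> {0..T} \<Longrightarrow>
      (u has_vector_derivative c *\<^sub>R Sigma_field \<alpha> (u s)) (at s within {0..T})"
    and v: "\<And>s. s \<in> {0..T} \<Longrightarrow>
      (v has_vector_derivative c *\<^sub>R Sigma_field \<alpha> (v s)) (at s within {0..T})"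
    and "u 0 = v 0" and t: "t \<in> {0..T}"
  shows "u t = v t"
proof -
  \<comment> \<open>Both solutions stay on the sphere of radius \<open>M\<close>. \<open>K\<close>
    is twice the Lipschitz constant of \<open>c\<close> times the field there, since differentiating
    a squared norm produces a factor 2.\<close>
  define M where "M = norm (v 0)"
  define K where "K = 2 * \<bar>c\<bar> * (4 * (1 + \<bar>\<alpha>\<bar>) * M)"
  have M: "norm (u s) \<le> M" "norm (v s) \<le> M" if "s \<in> {0..T}" for s
    using Sigma_flow_norm[OF u that] Sigma_flow_norm[OF v that] \<open>u 0 = v 0\<close>
    by (simp_all add: M_def)
  let ?d = "\<lambda>s. u s - v s"
  let ?D = "\<lambda>s. Sigma_field \<alpha> (u s) - Sigma_field \<alpha> (v s)"
  have "?d t \<bullet> ?d t = 0"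
  proof (rule gronwall_zero[where K = K and T = T and w = "\<lambda>s. ?d s \<bullet> ?d s"])
    fix s assume s: "s \<in> {0..T}"
    have "(?d has_derivative (\<lambda>h. h *\<^sub>R (c *\<^sub>R ?D s))) (at s within {0..T})"
      using has_vector_derivative_diff[OF u[OF s] v[OF s]]
      by (simp add: has_vector_derivative_def scaleR_diff_right)
    from has_derivative_inner[OF this this]
    show "((\<lambda>s. ?d s \<bullet> ?d s) has_real_derivative 2 * c * (?d s \<bullet> ?D s)) (at s within {0..T})"
      unfolding has_field_derivative_def
      by (rule has_derivative_eq_rhs) (auto simp: inner_commute algebra_simps)
    have "2 * c * (?d s \<bullet> ?D s) \<le> 2 * \<bar>c\<bar> * (norm (?d s) * norm (?D s))"
      using Cauchy_Schwarz_ineq2[of "?d s" "?D s"] abs_ge_self[of "2 * c * (?d s \<bullet> ?D s)"]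
        mult_left_mono[of "\<bar>?d s \<bullet> ?D s\<bar>" "norm (?d s) * norm (?D s)" "\<bar>2 * c\<bar>"]
      unfolding abs_mult by simp
    also have "\<dots> \<le> 2 * \<bar>c\<bar> * (norm (?d s) * (4 * (1 + \<bar>\<alpha>\<bar>) * M * norm (?d s)))"
      by (intro mult_left_mono Sigma_field_lipschitz M s) auto
    also have "\<dots> = K * (?d s \<bullet> ?d s)"
      by (simp add: K_def dot_square_norm power2_eq_square)
    finally show "2 * c * (?d s \<bullet> ?D s) \<le> K * (?d s \<bullet> ?d s)" .
  qed (use \<open>u 0 = v 0\<close> t in auto)
  then show ?thesis by simp
qed

lemma integral_curve_affine:
  assumes "integral_curve F \<gamma>"
  shows "integral_curve (\<lambda>q. e *\<^sub>R F q) (\<lambda>t. \<gamma> (a + e * t))"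
  unfolding integral_curve_def
proof
  fix t
  have "((\<lambda>t. a + e * t) has_vector_derivative e) (at t)"
    unfolding has_real_derivative_iff_has_vector_derivative[symmetric]
    by (auto intro!: derivative_eq_intros)
  moreover have "(\<gamma> has_vector_derivative F (\<gamma> (a + e * t))) (at (a + e * t))"
    using assms unfolding integral_curve_def by simp
  ultimately show "((\<lambda>t. \<gamma> (a + e * t)) has_vector_derivative e *\<^sub>R F (\<gamma> (a + e * t))) (at t)"
    using vector_diff_chain_at unfolding o_def by blast
qed

lemma Sigma_flow_unique:
  assumes u: "integral_curve (\<lambda>q. c *\<^sub>R Sigma_field \<alpha> q) u"
    and v: "integral_curve (\<lambda>q. c *\<^sub>R Sigma_field \<alpha> q) v"
    and "u a = v a"
  shows "u = v"
proof
  fix t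
  \<comment> \<open>The time change \<open>a + e * s\<close> moves the common point to time 0 and
    runs towards \<open>t\<close> from either side, at the price of the factor \<open>e\<close> on
    the field.\<close>
  define e :: real where "e = (if t \<ge> a then 1 else -1)"
  have *: "((\<lambda>s. w (a + e * s)) has_vector_derivative (e * c) *\<^sub>R Sigma_field \<alpha> (w (a + e * s)))
      (at s within {0..\<bar>t - a\<bar>})"
    if "integral_curve (\<lambda>q. c *\<^sub>R Sigma_field \<alpha> q) w" for s w
    using integral_curve_affine[OF that, of e a]
    unfolding integral_curve_def scaleR_scaleR by (rule allE[OF _ has_vector_derivative_at_within])
  have "u (a + e * \<bar>t - a\<bar>) = v (a + e * \<bar>t - a\<bar>)"
    by (rule Sigma_flow_unique_on[OF *[OF u] *[OF v]]) (auto simp: \<open>u a = v a\<close>)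
  then show "u t = v t" by (simp add: e_def split: if_splits)
qed


section \<open>Christoffel symbols of the metric and the geodesic equation in the left-invariant
  frame\<close>

lemma G_metric_nth:
  "G_metric \<alpha> p $ j $ l =
    (if j = l then (if j = 1 then exp (- 2 * p$3) else if j = 2 then exp (2 * \<alpha> * p$3) else 1) else 0)"
  using exhaust_3[of j] exhaust_3[of l] by (auto simp: G_metric_def vector_3)

lemma matrix_inv_G_metric:
  "matrix_inv (G_metric \<alpha> p) $ j $ l =
    (if j = l then (if j = 1 then exp (2 * p$3) else if j = 2 then exp (- 2 * \<alpha> * p$3) else 1) else 0)"
proof -
  define B :: "real^3^3" where
    "B = (\<chi> j l. if j = l then (if j = 1 then exp (2 * p$3) else if j = 2 then exp (- 2 * \<alpha> * p$3) else 1) else 0)"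
  have AB: "G_metric \<alpha> p ** B = mat 1" and BA: "B ** G_metric \<alpha> p = mat 1"
    by (auto simp: vec_eq_iff forall_3 matrix_matrix_mult_def sum_3 G_metric_nth B_def mat_def
        simp flip: exp_add)
  \<comment> \<open>\<open>matrix_inv\<close> is a choice among two-sided inverses, so
    \<open>B\<close> must be shown to be the only one.\<close>
  have "matrix_inv (G_metric \<alpha> p) = B"
    unfolding matrix_inv_def
  proof (rule some_equality)
    fix C assume "G_metric \<alpha> p ** C = mat 1 \<and> C ** G_metric \<alpha> p = mat 1"
    then have "B = (C ** G_metric \<alpha> p) ** B" by simp
    also have "\<dots> = C" by (simp add: AB flip: matrix_mul_assoc)
    finally show "C = B" ..
  qed (simp add: AB BA)
  then show ?thesis by (simp add: B_def)
qed

lemma partial_deriv_exp_coord: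
  fixes p :: "real^'n"
  shows "partial_deriv i (\<lambda>q. exp (c * q $ k)) p = (if i = k then c * exp (c * p $ k) else 0)"
proof -
  have "((\<lambda>q. exp (c * q $ k)) has_derivative (\<lambda>h. exp (c * p $ k) * (c * h $ k))) (at p)"
    by (auto intro!: derivative_eq_intros bounded_linear.has_derivative[OF bounded_linear_vec_nth])
  from frechet_derivative_at[OF this, symmetric] show ?thesis
    unfolding partial_deriv_def by (simp add: axis_def)
qed

lemma partial_deriv_const: "partial_deriv i (\<lambda>q. c) p = 0"
  by (simp add: partial_deriv_def)

lemma partial_deriv_G_metric:
  "partial_deriv i (\<lambda>q. G_metric \<alpha> q $ j $ l) p =
    (if j = l \<and> i = 3 then (if j = 1 then - 2 * exp (- 2 * p$3)
       else if j = 2 then 2 * \<alpha> * exp (2 * \<alpha> * p$3) else 0) else 0)"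
  using partial_deriv_exp_coord[of i "- 2" 3 p] partial_deriv_exp_coord[of i "2 * \<alpha>" 3 p]
  by (cases "j = l"; cases "j = 1"; cases "j = 2") (auto simp: G_metric_nth partial_deriv_const)

lemma G_metric_geodesic_acceleration:
  "(\<chi> k. - (\<Sum>i\<in>UNIV. \<Sum>j\<in>UNIV. christoffel (G_metric \<alpha>) p k i j * v $ i * v $ j)) =
    vector [2 * v$1 * v$3, - 2 * \<alpha> * v$2 * v$3,
      \<alpha> * exp (2 * \<alpha> * p$3) * (v$2)\<^sup>2 - exp (- 2 * p$3) * (v$1)\<^sup>2]"
  by (auto simp: vec_eq_iff forall_3 christoffel_def sum_3 matrix_inv_G_metric partial_deriv_G_metric
      vector_3 power2_eq_square algebra_simps simp flip: exp_add)

lemma G_frame_nth [simp]: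
  "G_frame \<alpha> p V $ 1 = exp (p$3) * V$1"
  "G_frame \<alpha> p V $ 2 = exp (- \<alpha> * p$3) * V$2"
  "G_frame \<alpha> p V $ 3 = V$3"
  by (simp_all add: G_frame_def vector_3)

text \<open>Cancels the metric coefficients against the frame factors in the third geodesic
  equation.\<close>

lemma exp_double_mult_square: "exp (2 * a) * (exp (- a) * y)\<^sup>2 = (y::real)\<^sup>2"
  by (simp add: power_mult_distrib exp_double exp_minus power_inverse)

lemma has_real_derivative_exp_mult:
  fixes f g :: "real \<Rightarrow> real"
  assumes "(g has_real_derivative g') (at t within S)" "(f has_real_derivative f') (at t within S)"
  shows "((\<lambda>t. exp (c * g t) * f t) has_real_derivative exp (c * g t) * (f' + c * g' * f t)) (at t within S)"
  using assms by (auto intro!: derivative_eq_intros simp: algebra_simps)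

text \<open>In frame coordinates the second-order equation splits: the velocity \<open>u\<close>
  obeys an autonomous equation, and \<open>\<gamma>\<close> is then recovered from \<open>u\<close>
  by a first-order one. This is left invariance of the metric.\<close>

lemma geodesic_on_G_metric_iff:
  "geodesic_on (G_metric \<alpha>) S \<gamma> \<longleftrightarrow>
    (\<exists>u. \<forall>t\<in>S. (\<gamma> has_vector_derivative G_frame \<alpha> (\<gamma> t) (u t)) (at t within S) \<and>
       (u has_vector_derivative Sigma_field \<alpha> (u t)) (at t within S))"
    (is "_ \<longleftrightarrow> (\<exists>u. ?framed u)")
proof
  assume "geodesic_on (G_metric \<alpha>) S \<gamma>"
  then obtain v where "\<forall>t\<in>S. (\<gamma> has_vector_derivative v t) (at t within S) \<and>
      (v has_vector_derivative vector [2 * v t$1 * v t$3, - 2 * \<alpha> * v t$2 * v t$3,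
      \<alpha> * exp (2 * \<alpha> * \<gamma> t$3) * (v t$2)\<^sup>2 - exp (- 2 * \<gamma> t$3) * (v t$1)\<^sup>2]) (at t within S)"
    unfolding geodesic_on_def G_metric_geodesic_acceleration ..
  note v = bspec[OF this, THEN conjunct1] bspec[OF this, THEN conjunct2]
  \<comment> \<open>The inverse of the frame map at \<open>\<gamma> t\<close>, applied to the
    coordinate velocity.\<close>
  define u where
    "u t = (vector [exp (- \<gamma> t$3) * v t$1, exp (\<alpha> * \<gamma> t$3) * v t$2, v t$3] :: real^3)" for t
  have "?framed u"
  proof (intro ballI conjI)
    fix t assume t: "t \<in> S"
    have frame: "G_frame \<alpha> (\<gamma> t) (u t) = v t"
      by (simp add: vec_eq_iff forall_3 u_def vector_3 exp_minus)
    then show "(\<gamma> has_vector_derivative G_frame \<alpha> (\<gamma> t) (u t)) (at t within S)"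
      using v(1)[OF t] by simp
    show "(u has_vector_derivative Sigma_field \<alpha> (u t)) (at t within S)"
    proof -
      note \<gamma>' = v(1)[OF t, unfolded has_vector_derivative_vec_iff, rule_format]
      note v' = v(2)[OF t, unfolded has_vector_derivative_vec_iff, rule_format]
      have v1: "((\<lambda>t. v t $ 1) has_real_derivative 2 * v t$1 * v t$3) (at t within S)"
        and v2: "((\<lambda>t. v t $ 2) has_real_derivative - 2 * \<alpha> * v t$2 * v t$3) (at t within S)"
        using v'[of 1] v'[of 2] by (simp_all add: vector_3)
      have "\<alpha> * exp (2 * \<alpha> * \<gamma> t$3) * (v t$2)\<^sup>2 - exp (- 2 * \<gamma> t$3) * (v t$1)\<^sup>2
          = Sigma_field \<alpha> (u t) $ 3"
        using exp_double_mult_square[of "\<alpha> * \<gamma> t$3" "u t$2"] exp_double_mult_square[of "- \<gamma> t$3" "u t$1"] frame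
        by (simp add: frame[symmetric] mult.assoc)
      moreover have "((\<lambda>t. u t $ 1) has_real_derivative Sigma_field \<alpha> (u t) $ 1) (at t within S)"
        using has_real_derivative_exp_mult[OF \<gamma>'[of 3] v1, of "- 1"]
        by (simp add: u_def vector_3 algebra_simps)
      moreover have "((\<lambda>t. u t $ 2) has_real_derivative Sigma_field \<alpha> (u t) $ 2) (at t within S)"
        using has_real_derivative_exp_mult[OF \<gamma>'[of 3] v2, of \<alpha>]
        by (simp add: u_def vector_3 algebra_simps)
      ultimately show ?thesis
        using v'[of 3] unfolding has_vector_derivative_vec_iff forall_3
        by (simp add: u_def vector_3)
    qed
  qed
  then show "\<exists>u. ?framed u" by (rule exI[of _ u])
next
  assume "\<exists>u. ?framed u"
  then obtain u where "?framed u" ..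
  note u = bspec[OF this, THEN conjunct1] bspec[OF this, THEN conjunct2]
  have "((\<lambda>t. G_frame \<alpha> (\<gamma> t) (u t)) has_vector_derivative
      vector [2 * v$1 * v$3, - 2 * \<alpha> * v$2 * v$3,
      \<alpha> * exp (2 * \<alpha> * \<gamma> t$3) * (v$2)\<^sup>2 - exp (- 2 * \<gamma> t$3) * (v$1)\<^sup>2]) (at t within S)"
    if t: "t \<in> S" and v: "v = G_frame \<alpha> (\<gamma> t) (u t)" for t v
  proof -
    note \<gamma>' = u(1)[OF t, unfolded has_vector_derivative_vec_iff, rule_format]
    note u' = u(2)[OF t, unfolded has_vector_derivative_vec_iff, rule_format]
    have u1: "((\<lambda>t. u t $ 1) has_real_derivative u t$1 * u t$3) (at t within S)"
      and u2: "((\<lambda>t. u t $ 2) has_real_derivative - \<alpha> * u t$2 * u t$3) (at t within S)"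
      using u'[of 1] u'[of 2] by simp_all
    have "((\<lambda>t. exp (\<gamma> t $ 3) * u t $ 1) has_real_derivative 2 * v$1 * v$3) (at t within S)"
      using has_real_derivative_exp_mult[OF \<gamma>'[of 3] u1, of 1] by (simp add: v algebra_simps)
    moreover have "((\<lambda>t. exp (- \<alpha> * \<gamma> t $ 3) * u t $ 2) has_real_derivative - 2 * \<alpha> * v$2 * v$3)
        (at t within S)"
      using has_real_derivative_exp_mult[OF \<gamma>'[of 3] u2, of "- \<alpha>"] by (simp add: v algebra_simps)
    moreover have "\<alpha> * exp (2 * \<alpha> * \<gamma> t$3) * (v$2)\<^sup>2 - exp (- 2 * \<gamma> t$3) * (v$1)\<^sup>2
        = Sigma_field \<alpha> (u t) $ 3"
      using exp_double_mult_square[of "\<alpha> * \<gamma> t$3" "u t$2"] exp_double_mult_square[of "- \<gamma> t$3" "u t$1"]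
      by (simp add: v mult.assoc)
    ultimately show ?thesis
      using u'[of 3] unfolding has_vector_derivative_vec_iff forall_3
      by (simp add: vector_3)
  qed
  then show "geodesic_on (G_metric \<alpha>) S \<gamma>"
    unfolding geodesic_on_def G_metric_geodesic_acceleration using u(1)
    by (intro exI[of _ "\<lambda>t. G_frame \<alpha> (\<gamma> t) (u t)"] ballI conjI) simp_all
qed

section \<open>Uniqueness of geodesics and evaluation of the exponential map\<close>

lemma has_real_derivative_unique_on:
  fixes f g :: "real \<Rightarrow> real"
  assumes "\<And>s. s \<in> {0..T} \<Longrightarrow> (f has_real_derivative f' s) (at s within {0..T})"
    and "\<And>s. s \<in> {0..T} \<Longrightarrow> (g has_real_derivative f' s) (at s within {0..T})"
    and "f 0 = g 0" "t \<in> {0..T}"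
  shows "f t = g t"
proof -
  have "((\<lambda>s. f s - g s) has_derivative (\<lambda>h. 0)) (at s within {0..T})" if "s \<in> {0..T}" for s
    using DERIV_diff[OF assms(1,2)[OF that]] by (simp add: has_field_derivative_def lambda_zero)
  then obtain k where "\<And>s. s \<in> {0..T} \<Longrightarrow> f s - g s = k"
    using has_derivative_zero_constant[of "{0..T}" "\<lambda>s. f s - g s"] by auto
  from this[of t] this[of 0] show ?thesis using assms(3,4) by auto
qed

text \<open>The system is triangular: the third derivative involves only \<open>u\<close>, and once
  the third coordinates agree, the exponential factors in the other two derivatives agree as
  well.\<close>

lemma framed_curve_unique_on:
  assumes "\<And>t. t \<in> {0..T} \<Longrightarrow>
      (\<gamma> has_vector_derivative G_frame \<alpha> (\<gamma> t) (u t)) (at t within {0..T})"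
    and "\<And>t. t \<in> {0..T} \<Longrightarrow>
      (\<eta> has_vector_derivative G_frame \<alpha> (\<eta> t) (u t)) (at t within {0..T})"
    and "\<gamma> 0 = \<eta> 0" "t \<in> {0..T}"
  shows "\<gamma> t = \<eta> t"
proof -
  note \<gamma> = assms(1)[unfolded has_vector_derivative_vec_iff, rule_format]
  note \<eta> = assms(2)[unfolded has_vector_derivative_vec_iff, rule_format]
  have 3: "\<gamma> s $ 3 = \<eta> s $ 3" if "s \<in> {0..T}" for s
  proof (rule has_real_derivative_unique_on[OF _ _ _ that])
    show "((\<lambda>s. \<gamma> s $ 3) has_real_derivative u r $ 3) (at r within {0..T})"
      "((\<lambda>s. \<eta> s $ 3) has_real_derivative u r $ 3) (at r within {0..T})"
      if "r \<in> {0..T}" for r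
      using \<gamma>[OF that, of 3] \<eta>[OF that, of 3] by simp_all
  qed (simp add: \<open>\<gamma> 0 = \<eta> 0\<close>)
  have "\<gamma> t $ 1 = \<eta> t $ 1"
  proof (rule has_real_derivative_unique_on[OF _ _ _ \<open>t \<in> {0..T}\<close>])
    show "((\<lambda>s. \<gamma> s $ 1) has_real_derivative exp (\<gamma> r $ 3) * u r $ 1) (at r within {0..T})"
      "((\<lambda>s. \<eta> s $ 1) has_real_derivative exp (\<gamma> r $ 3) * u r $ 1) (at r within {0..T})"
      if "r \<in> {0..T}" for r
      using \<gamma>[OF that, of 1] \<eta>[OF that, of 1] 3[OF that] by simp_all
  qed (simp add: \<open>\<gamma> 0 = \<eta> 0\<close>)
  moreover have "\<gamma> t $ 2 = \<eta> t $ 2"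
  proof (rule has_real_derivative_unique_on[OF _ _ _ \<open>t \<in> {0..T}\<close>])
    show "((\<lambda>s. \<gamma> s $ 2) has_real_derivative exp (- \<alpha> * \<gamma> r $ 3) * u r $ 2) (at r within {0..T})"
      "((\<lambda>s. \<eta> s $ 2) has_real_derivative exp (- \<alpha> * \<gamma> r $ 3) * u r $ 2) (at r within {0..T})"
      if "r \<in> {0..T}" for r
      using \<gamma>[OF that, of 2] \<eta>[OF that, of 2] 3[OF that] by simp_all
  qed (simp add: \<open>\<gamma> 0 = \<eta> 0\<close>)
  ultimately show ?thesis
    using 3[OF \<open>t \<in> {0..T}\<close>] by (simp add: vec_eq_iff forall_3)
qed

text \<open>The exponential map is a definite description, so a geodesic determines its value only
  together with uniqueness: first of the frame velocity, then of the curve.\<close>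

lemma G_exp_eqI:
  assumes \<gamma>: "\<And>t. t \<in> {0..1} \<Longrightarrow>
      (\<gamma> has_vector_derivative G_frame \<alpha> (\<gamma> t) (u t)) (at t within {0..1})"
    and u: "\<And>t. t \<in> {0..1} \<Longrightarrow>
      (u has_vector_derivative Sigma_field \<alpha> (u t)) (at t within {0..1})"
    and "\<gamma> 0 = 0" "u 0 = V"
  shows "G_exp \<alpha> V = \<gamma> 1"
  unfolding G_exp_def riemannian_exp_def
proof (rule the_equality)
  show "\<exists>\<gamma>'. geodesic_on (G_metric \<alpha>) {0..1} \<gamma>' \<and> \<gamma>' 0 = 0 \<and>
      (\<gamma>' has_vector_derivative G_frame \<alpha> 0 V) (at 0 within {0..1}) \<and> \<gamma>' 1 = \<gamma> 1"
  proof (intro exI[of _ \<gamma>] conjI)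
    show "geodesic_on (G_metric \<alpha>) {0..1} \<gamma>"
      using \<gamma> u unfolding geodesic_on_G_metric_iff by blast
    show "(\<gamma> has_vector_derivative G_frame \<alpha> 0 V) (at 0 within {0..1})"
      using \<gamma>[of 0] \<open>\<gamma> 0 = 0\<close> \<open>u 0 = V\<close> by simp
  qed (use \<open>\<gamma> 0 = 0\<close> in simp_all)
next
  fix q
  assume "\<exists>\<eta>. geodesic_on (G_metric \<alpha>) {0..1} \<eta> \<and> \<eta> 0 = 0 \<and>
      (\<eta> has_vector_derivative G_frame \<alpha> 0 V) (at 0 within {0..1}) \<and> \<eta> 1 = q"
  then obtain \<eta> v where \<eta>: "\<And>t. t \<in> {0..1} \<Longrightarrow>
      (\<eta> has_vector_derivative G_frame \<alpha> (\<eta> t) (v t)) (at t within {0..1})"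
    and v: "\<And>t. t \<in> {0..1} \<Longrightarrow>
      (v has_vector_derivative Sigma_field \<alpha> (v t)) (at t within {0..1})"
    and "\<eta> 0 = 0" "\<eta> 1 = q"
    and \<eta>0: "(\<eta> has_vector_derivative G_frame \<alpha> 0 V) (at 0 within {0..1})"
    unfolding geodesic_on_G_metric_iff by blast
  \<comment> \<open>The velocity \<open>v\<close> comes from an existential statement; it is tied to
    \<open>V\<close> by uniqueness of the one-sided derivative at 0, a limit point of the
    interval.\<close>
  have "G_frame \<alpha> 0 (v 0) = G_frame \<alpha> 0 V"
    using vector_derivative_unique_within[OF _ \<eta>0, of "G_frame \<alpha> (\<eta> 0) (v 0)"] \<eta>[of 0] \<open>\<eta> 0 = 0\<close>
    by (simp add: trivial_limit_within islimpt_Icc)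
  then have "v 0 = V"
    by (simp add: vec_eq_iff forall_3)
  then have vu: "v t = u t" if "t \<in> {0..1}" for t
    using u v \<open>u 0 = V\<close> that by (intro Sigma_flow_unique_on[of 1 v 1 \<alpha> u t]) simp_all
  have "\<eta> 1 = \<gamma> 1"
  proof (rule framed_curve_unique_on[of 1])
    show "(\<eta> has_vector_derivative G_frame \<alpha> (\<eta> t) (u t)) (at t within {0..1})"
      if "t \<in> {0..1}" for t
      using \<eta>[OF that] vu[OF that] by simp
  qed (use \<gamma> \<open>\<eta> 0 = 0\<close> \<open>\<gamma> 0 = 0\<close> in auto)
  then show "q = \<gamma> 1" using \<open>\<eta> 1 = q\<close> by simp
qed

section \<open>The backward flow line, its symmetries, and a closed formula for
  \<open>Lambda\<close>\<close>

lemma antiderivative_exists: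
  fixes f :: "real \<Rightarrow> real"
  assumes "\<And>t. isCont f t"
  obtains F where "\<And>t. (F has_real_derivative f t) (at t)" "F 0 = 0"
proof -
  obtain G where G: "\<And>t. (G has_real_derivative f t) (at t)"
    using einterval_antiderivative[of "-\<infinity>" "\<infinity>" f] assms
    by (auto simp: has_real_derivative_iff_has_vector_derivative)
  show thesis
    by (rule that[of "\<lambda>t. G t - G 0"]) (auto intro!: derivative_eq_intros G)
qed

text \<open>The antiderivatives are taken on the whole line so that times \<open>t\<close> and
  \<open>- t\<close> can be compared. \<open>start_right\<close> says that \<open>z\<close> has
  positive derivative at time 0.\<close>

locale backward_flow =
  fixes \<alpha> :: real and p :: "real \<Rightarrow> real^3" and \<zeta> A B :: "real \<Rightarrow> real"
  assumes alpha_pos: "0 < \<alpha>"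
    and flow: "integral_curve (\<lambda>q. - Sigma_field \<alpha> q) p"
    and start_sphere: "norm (p 0) = 1"
    and start_pos: "p 0 $ 1 > 0" "p 0 $ 2 > 0"
    and start_plane: "p 0 $ 3 = 0"
    and start_right: "\<alpha> * (p 0 $ 2)\<^sup>2 < (p 0 $ 1)\<^sup>2"
    and zeta_deriv: "(\<zeta> has_real_derivative p t $ 3) (at t)"
    and zeta_0: "\<zeta> 0 = 0"
    and A_deriv: "(A has_real_derivative (p t $ 1)\<^sup>2) (at t)"
    and A_0: "A 0 = 0"
    and B_deriv: "(B has_real_derivative (p t $ 2)\<^sup>2) (at t)"
    and B_0: "B 0 = 0"
begin

abbreviation x where "x t \<equiv> p t $ 1"
abbreviation y where "y t \<equiv> p t $ 2"
abbreviation z where "z t \<equiv> p t $ 3"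

lemma x_deriv: "(x has_real_derivative - (x t * z t)) (at t)"
  and y_deriv: "(y has_real_derivative \<alpha> * y t * z t) (at t)"
  and z_deriv: "(z has_real_derivative (x t)\<^sup>2 - \<alpha> * (y t)\<^sup>2) (at t)"
  using flow unfolding integral_curve_def has_vector_derivative_vec_iff forall_3 by auto

text \<open>The chain-rule form also covers reparametrised times such as \<open>- t\<close> and
  \<open>t - 2 * t * s\<close>.\<close>

lemmas [derivative_intros] =
  DERIV_chain2[OF x_deriv] DERIV_chain2[OF y_deriv] DERIV_chain2[OF z_deriv]
  DERIV_chain2[OF zeta_deriv] DERIV_chain2[OF A_deriv] DERIV_chain2[OF B_deriv]

lemma sphere: "(x t)\<^sup>2 + (y t)\<^sup>2 + (z t)\<^sup>2 = 1"
proof -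
  have "\<forall>t. ((\<lambda>t. (x t)\<^sup>2 + (y t)\<^sup>2 + (z t)\<^sup>2) has_real_derivative 0) (at t)"
    by (auto intro!: derivative_eq_intros simp: algebra_simps power2_eq_square)
  then have "(x t)\<^sup>2 + (y t)\<^sup>2 + (z t)\<^sup>2 = (x 0)\<^sup>2 + (y 0)\<^sup>2 + (z 0)\<^sup>2"
    by (rule DERIV_isconst_all)
  also have "\<dots> = (norm (p 0))\<^sup>2"
    unfolding power2_norm_eq_inner inner_vec_def sum_3 by (simp add: power2_eq_square)
  finally show ?thesis by (simp add: start_sphere)
qed

text \<open>Reversing time and negating the third coordinate turns flow lines into flow lines, and
  fixes the starting point because it lies in the plane \<open>z = 0\<close>; uniqueness does the
  rest.\<close>

lemma reflection:
  "x (- t) = x t" "y (- t) = y t" "z (- t) = - z t"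
proof -
  let ?q = "\<lambda>t. vector [x (- t), y (- t), - z (- t)] :: real^3"
  have "integral_curve (\<lambda>q. (- 1) *\<^sub>R Sigma_field \<alpha> q) ?q"
    unfolding integral_curve_def has_vector_derivative_vec_iff forall_3
    by (auto simp: vector_3 intro!: derivative_eq_intros)
  moreover have "integral_curve (\<lambda>q. (- 1) *\<^sub>R Sigma_field \<alpha> q) p"
    using flow by simp
  moreover have "?q 0 = p 0"
    by (simp add: vec_eq_iff forall_3 vector_3 start_plane)
  ultimately have "?q = p"
    by (rule Sigma_flow_unique)
  then have "?q (- t) = p (- t)" by (rule fun_cong)
  then show "x (- t) = x t" "y (- t) = y t" "z (- t) = - z t"
    by (simp_all add: vec_eq_iff forall_3 vector_3)
qed

text \<open>The equation for \<open>x\<close> is linear with coefficient \<open>- z\<close>, so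
  \<open>exp (\<zeta> t)\<close> is an integrating factor; \<open>y\<close> is treated
  alike.\<close>

lemma x_eq: "x t = x 0 * exp (- \<zeta> t)"
proof -
  have "\<forall>t. ((\<lambda>t. x t * exp (\<zeta> t)) has_real_derivative 0) (at t)"
    by (auto intro!: derivative_eq_intros simp: algebra_simps)
  then have "x t * exp (\<zeta> t) = x 0 * exp (\<zeta> 0)"
    by (rule DERIV_isconst_all)
  then show ?thesis by (simp add: zeta_0 exp_minus field_simps)
qed

lemma y_eq: "y t = y 0 * exp (\<alpha> * \<zeta> t)"
proof -
  have "\<forall>t. ((\<lambda>t. y t * exp (- (\<alpha> * \<zeta> t))) has_real_derivative 0) (at t)"
    by (auto intro!: derivative_eq_intros simp: algebra_simps)
  then have "y t * exp (- (\<alpha> * \<zeta> t)) = y 0 * exp (- (\<alpha> * \<zeta> 0))"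
    by (rule DERIV_isconst_all)
  then show ?thesis by (simp add: zeta_0 exp_minus field_simps)
qed

lemma x_pos: "x t > 0" and y_pos: "y t > 0"
  using start_pos by (simp_all add: x_eq[of t] y_eq[of t])

text \<open>An odd integrand has an even antiderivative, and an even integrand an odd one when it
  vanishes at 0.\<close>

lemma odd_antiderivatives: "\<zeta> (- t) = \<zeta> t" "A (- t) = - A t" "B (- t) = - B t"
proof -
  have "\<forall>t. ((\<lambda>t. \<zeta> (- t) - \<zeta> t) has_real_derivative 0) (at t)"
    "\<forall>t. ((\<lambda>t. A (- t) + A t) has_real_derivative 0) (at t)"
    "\<forall>t. ((\<lambda>t. B (- t) + B t) has_real_derivative 0) (at t)"
    by (auto intro!: derivative_eq_intros simp: reflection)
  from this[THEN DERIV_isconst_all, of t 0]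
  show "\<zeta> (- t) = \<zeta> t" "A (- t) = - A t" "B (- t) = - B t"
    by (simp_all add: A_0 B_0)
qed

text \<open>Both sides vanish at 0 and have derivative \<open>x^2 - \<alpha> y^2\<close>. This later
  trades \<open>B\<close> for \<open>A\<close>.\<close>

lemma A_minus_B: "A t - \<alpha> * B t = z t"
proof -
  have "\<forall>t. ((\<lambda>t. A t - \<alpha> * B t - z t) has_real_derivative 0) (at t)"
    by (auto intro!: derivative_eq_intros)
  then have "A t - \<alpha> * B t - z t = A 0 - \<alpha> * B 0 - z 0"
    by (rule DERIV_isconst_all)
  then show ?thesis by (simp add: A_0 B_0 start_plane)
qed

lemma A_pos: "0 < t \<Longrightarrow> A t > 0" and B_pos: "0 < t \<Longrightarrow> B t > 0"
  using DERIV_pos_imp_increasing[of 0 t A] DERIV_pos_imp_increasing[of 0 t B]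
    A_deriv B_deriv x_pos y_pos A_0 B_0
  by (metis zero_less_power)+

text \<open>Integrating the reversed curve \<open>s \<mapsto> p (t - 2 t s)\<close> in the frame; its third coordinate is
  \<open>\<zeta> t - \<zeta> (t - 2 t s)\<close>, and \<open>x\<close> and \<open>y\<close> are exponentials of \<open>\<zeta>\<close>.\<close>

lemma Lambda_eq: "Lambda \<alpha> p t = vector [2 * A t / x t, 2 * B t / y t, 0]"
proof -
  define r where "r s = t - 2 * t * s" for s
  \<comment> \<open>The field is homogeneous of degree 2, so the factor \<open>2 * t\<close> matches
    the speed of the time change \<open>r\<close>, whose negative sign turns the backward flow into
    the forward one.\<close>
  define u where "u s = (2 * t) *\<^sub>R p (r s)" for s
  define \<gamma> where "\<gamma> s = (vector [(A t - A (r s)) / x t, (B t - B (r s)) / y t,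
      \<zeta> t - \<zeta> (r s)] :: real^3)" for s
  have ex: "exp (\<zeta> t - \<zeta> (r s)) = x (r s) / x t" for s
    using start_pos by (simp add: x_eq[of t] x_eq[of "r s"] exp_minus exp_diff field_simps)
  have ey: "exp (- \<alpha> * (\<zeta> t - \<zeta> (r s))) = y (r s) / y t" for s
    using start_pos by (simp add: y_eq[of t] y_eq[of "r s"] algebra_simps flip: exp_diff)
  have "G_exp \<alpha> ((2 * t) *\<^sub>R p t) = \<gamma> 1"
  proof (rule G_exp_eqI[where u = u])
    fix s
    have \<gamma>: "((\<lambda>s. \<gamma> s $ 1) has_real_derivative G_frame \<alpha> (\<gamma> s) (u s) $ 1) (at s)"
      "((\<lambda>s. \<gamma> s $ 2) has_real_derivative G_frame \<alpha> (\<gamma> s) (u s) $ 2) (at s)"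
      "((\<lambda>s. \<gamma> s $ 3) has_real_derivative G_frame \<alpha> (\<gamma> s) (u s) $ 3) (at s)"
      unfolding G_frame_nth \<gamma>_def vector_3 ex ey u_def vector_scaleR_component
      unfolding r_def
      using x_pos[of t] y_pos[of t]
      by (auto intro!: derivative_eq_intros simp: field_simps power2_eq_square)
    then show "(\<gamma> has_vector_derivative G_frame \<alpha> (\<gamma> s) (u s)) (at s within {0..1})"
      unfolding has_vector_derivative_vec_iff forall_3 by (blast intro: has_field_derivative_at_within)
    have "((\<lambda>s. u s $ 1) has_real_derivative Sigma_field \<alpha> (u s) $ 1) (at s)"
      "((\<lambda>s. u s $ 2) has_real_derivative Sigma_field \<alpha> (u s) $ 2) (at s)"
      "((\<lambda>s. u s $ 3) has_real_derivative Sigma_field \<alpha> (u s) $ 3) (at s)"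
      unfolding Sigma_field_nth u_def vector_scaleR_component
      unfolding r_def
      by (auto intro!: derivative_eq_intros simp: algebra_simps power2_eq_square)
    then show "(u has_vector_derivative Sigma_field \<alpha> (u s)) (at s within {0..1})"
      unfolding has_vector_derivative_vec_iff forall_3 by (blast intro: has_field_derivative_at_within)
  qed (simp_all add: u_def \<gamma>_def r_def vec_eq_iff forall_3 vector_3)
  \<comment> \<open>Here \<open>r 1 = - t\<close>, so parity doubles \<open>A t\<close> and
    \<open>B t\<close> and cancels the third coordinate.\<close>
  also have "\<gamma> 1 = vector [2 * A t / x t, 2 * B t / y t, 0]"
    by (simp add: \<gamma>_def r_def odd_antiderivatives)
  finally show ?thesis by (simp add: Lambda_def)
qed

end

section \<open>Strict monotonicity of both coordinates of \<open>Lambda\<close>\<close>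

context backward_flow
begin

text \<open>This is the sign condition for the derivative in \<open>ratio_deriv\<close>, with
  denominators cleared.\<close>

lemma increment_inequality: "(x t)\<^sup>2 * ((y t)\<^sup>2 - (y 0)\<^sup>2) \<le> \<alpha> * (y t)\<^sup>2 * ((x 0)\<^sup>2 - (x t)\<^sup>2)"
proof -
  let ?E = "exp (2 * \<zeta> t)" and ?D = "exp (- (2 * \<alpha> * \<zeta> t))"
  have X: "(x 0)\<^sup>2 = (x t)\<^sup>2 * ?E"
    by (simp add: x_eq[of t] power_mult_distrib exp_double exp_minus power_inverse)
  have Y: "(y 0)\<^sup>2 = (y t)\<^sup>2 * ?D"
    using exp_double[of "\<alpha> * \<zeta> t"]
    by (simp add: y_eq[of t] power_mult_distrib exp_minus mult.assoc)
  \<comment> \<open>The two tangent-line bounds meet at one value: \<open>1 - ?D \<le> 2 * \<alpha>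
    * \<zeta> t \<le> \<alpha> * (?E - 1)\<close>.\<close>
  have "1 + 2 * \<zeta> t \<le> ?E" "1 + - (2 * \<alpha> * \<zeta> t) \<le> ?D"
    by (rule exp_ge_add_one_self)+
  moreover from this(1) have "\<alpha> * (2 * \<zeta> t) \<le> \<alpha> * (?E - 1)"
    using alpha_pos by (intro mult_left_mono) linarith+
  ultimately have "0 \<le> (x t)\<^sup>2 * (y t)\<^sup>2 * (\<alpha> * (?E - 1) - (1 - ?D))"
    by simp
  then show ?thesis
    unfolding X Y by (simp add: algebra_simps)
qed

lemma ratio_deriv:
  assumes "z t > 0"
  obtains D where "((\<lambda>s. ((x 0)\<^sup>2 - (x s)\<^sup>2) / z s - A s) has_real_derivative D) (at t)" "0 \<le> D"
proof
  let ?X = "(x 0)\<^sup>2 - (x t)\<^sup>2"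
  show "((\<lambda>s. ((x 0)\<^sup>2 - (x s)\<^sup>2) / z s - A s) has_real_derivative
      (x t)\<^sup>2 - ?X * ((x t)\<^sup>2 - \<alpha> * (y t)\<^sup>2) / (z t)\<^sup>2) (at t)"
    using assms by (auto intro!: derivative_eq_intros simp: field_simps power2_eq_square)
  \<comment> \<open>Comparing the sphere equation at times \<open>t\<close> and 0. After this
    substitution the terms \<open>?X * (x t)^2\<close> cancel and
    \<open>increment_inequality\<close> remains.\<close>
  have z: "(z t)\<^sup>2 = ?X - ((y t)\<^sup>2 - (y 0)\<^sup>2)"
    using sphere[of t] sphere[of 0] start_plane by simp
  have "?X * ((x t)\<^sup>2 - \<alpha> * (y t)\<^sup>2) \<le> (x t)\<^sup>2 * (z t)\<^sup>2"
    unfolding z using increment_inequality[of t] by (simp add: algebra_simps)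
  then show "0 \<le> (x t)\<^sup>2 - ?X * ((x t)\<^sup>2 - \<alpha> * (y t)\<^sup>2) / (z t)\<^sup>2"
    using assms by (simp add: divide_le_eq)
qed

text \<open>The quotient has the form 0/0. Dividing numerator and denominator by \<open>s\<close>
  gives difference quotients: the numerator has derivative 0 because \<open>z 0 = 0\<close>, while
  \<open>z\<close> has the nonzero derivative given by \<open>start_right\<close>.\<close>

lemma ratio_tendsto: "((\<lambda>s. ((x 0)\<^sup>2 - (x s)\<^sup>2) / z s - A s) \<longlongrightarrow> 0) (at_right 0)"
proof -
  have "((\<lambda>s. (x 0)\<^sup>2 - (x s)\<^sup>2) has_real_derivative 0) (at 0)"
    using start_plane by (auto intro!: derivative_eq_intros)
  from has_field_derivative_at_within[OF this, of "{0<..}"]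
  have num: "((\<lambda>s. ((x 0)\<^sup>2 - (x s)\<^sup>2) / s) \<longlongrightarrow> 0) (at_right 0)"
    unfolding has_field_derivative_iff by simp
  from has_field_derivative_at_within[OF z_deriv[of 0], of "{0<..}"]
  have den: "((\<lambda>s. z s / s) \<longlongrightarrow> (x 0)\<^sup>2 - \<alpha> * (y 0)\<^sup>2) (at_right 0)"
    unfolding has_field_derivative_iff start_plane by simp
  have "((\<lambda>s. (((x 0)\<^sup>2 - (x s)\<^sup>2) / s) / (z s / s)) \<longlongrightarrow> 0 / ((x 0)\<^sup>2 - \<alpha> * (y 0)\<^sup>2))
      (at_right 0)"
    using start_right by (intro tendsto_divide num den) linarith
  moreover have "\<forall>\<^sub>F s in at_right 0. (((x 0)\<^sup>2 - (x s)\<^sup>2) / s) / (z s / s) = ((x 0)\<^sup>2 - (x s)\<^sup>2) / z s"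
    by (rule eventually_at_rightI[of 0 1]) auto
  ultimately have ratio: "((\<lambda>s. ((x 0)\<^sup>2 - (x s)\<^sup>2) / z s) \<longlongrightarrow> 0 / ((x 0)\<^sup>2 - \<alpha> * (y 0)\<^sup>2)) (at_right 0)"
    by (rule Lim_transform_eventually)
  have "(A \<longlongrightarrow> A 0) (at_right 0)"
    unfolding continuous_within[symmetric]
    by (rule continuous_at_imp_continuous_at_within[OF DERIV_isCont[OF A_deriv]])
  from tendsto_diff[OF ratio this] show ?thesis
    by (simp add: A_0)
qed

text \<open>A nondecreasing function with right limit 0 at 0 is nonnegative at
  \<open>t\<close>.\<close>

lemma z_mult_A_le:
  assumes pos: "\<And>s. 0 < s \<Longrightarrow> s \<le> t \<Longrightarrow> z s > 0" and "0 < t"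
  shows "z t * A t \<le> (x 0)\<^sup>2 - (x t)\<^sup>2"
proof -
  let ?F = "\<lambda>s. ((x 0)\<^sup>2 - (x s)\<^sup>2) / z s - A s"
  have "?F s \<le> ?F t" if "0 < s" "s < t" for s
  proof (rule DERIV_nonneg_imp_nondecreasing[where f = ?F])
    fix r assume "s \<le> r" "r \<le> t"
    then have "z r > 0" using pos \<open>0 < s\<close> by simp
    then obtain D where "(?F has_real_derivative D) (at r)" "0 \<le> D"
      by (rule ratio_deriv)
    then show "\<exists>D. (?F has_real_derivative D) (at r) \<and> 0 \<le> D"
      by (intro exI[of _ D] conjI)
  qed (use that in simp)
  then have "\<forall>\<^sub>F s in at_right 0. ?F s \<le> ?F t"
    using \<open>0 < t\<close> by (intro eventually_at_rightI[of 0 t]) auto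
  then have "0 \<le> ?F t"
    by (intro tendsto_upperbound[OF ratio_tendsto]) auto
  then show ?thesis
    using pos[of t] \<open>0 < t\<close> by (simp add: pos_le_divide_eq mult.commute)
qed

lemma Lambda_strict_mono:
  assumes pos: "\<And>s. 0 < s \<Longrightarrow> s < \<rho> \<Longrightarrow> z s > 0" and t: "0 < t" "t < \<rho>"
  shows "Lambda \<alpha> p t $ 1 < Lambda \<alpha> p \<rho> $ 1" "Lambda \<alpha> p t $ 2 < Lambda \<alpha> p \<rho> $ 2"
proof -
  have a_deriv: "((\<lambda>s. 2 * A s / x s) has_real_derivative 2 * x s + 2 * A s * z s / x s) (at s)"
    and b_deriv: "((\<lambda>s. 2 * B s / y s) has_real_derivative 2 * ((y s)\<^sup>2 - \<alpha> * z s * B s) / y s) (at s)"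
    for s
    using x_pos[of s] y_pos[of s]
    by (auto intro!: derivative_eq_intros simp: field_simps power2_eq_square)
  have "2 * A t / x t < 2 * A \<rho> / x \<rho>"
  \<comment> \<open>\<open>z\<close> is known to be positive only before \<open>\<rho>\<close>, so
    derivatives are checked on the open interval and continuity reaches the endpoint.\<close>
  proof (rule DERIV_pos_imp_increasing_open[OF \<open>t < \<rho>\<close>])
    fix s assume s: "t < s" "s < \<rho>"
    have "0 < 2 * A s * z s / x s"
      using A_pos[of s] pos[of s] x_pos[of s] s t by simp
    then have "0 < 2 * x s + 2 * A s * z s / x s"
      using x_pos[of s] by simp
    then show "\<exists>D. ((\<lambda>s. 2 * A s / x s) has_real_derivative D) (at s) \<and> 0 < D"
      using a_deriv[of s] by blast
  qed (rule DERIV_continuous_on[OF has_field_derivative_at_within[OF a_deriv]])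
  then show "Lambda \<alpha> p t $ 1 < Lambda \<alpha> p \<rho> $ 1"
    by (simp add: Lambda_eq vector_3)
  have "2 * B t / y t < 2 * B \<rho> / y \<rho>"
  proof (rule DERIV_pos_imp_increasing_open[OF \<open>t < \<rho>\<close>])
    fix s assume s: "t < s" "s < \<rho>"
    have B: "\<alpha> * B s = A s - z s"
      using A_minus_B[of s] by simp
    have "\<alpha> * z s * B s = z s * (\<alpha> * B s)" by simp
    also have "\<dots> = z s * A s - (z s)\<^sup>2"
      unfolding B by (simp add: power2_eq_square algebra_simps)
    also have "\<dots> \<le> (x 0)\<^sup>2 - (x s)\<^sup>2 - (z s)\<^sup>2"
      using z_mult_A_le[of s] pos s t by simp
    \<comment> \<open>By the sphere equation at times \<open>s\<close> and 0 the left side equals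
      \<open>(y s)^2 - (y 0)^2\<close>.\<close>
    also have "\<dots> < (y s)\<^sup>2"
      using sphere[of s] sphere[of 0] zero_less_power[OF start_pos(2), of 2]
      unfolding start_plane power_zero_numeral by linarith
    finally have "0 < 2 * ((y s)\<^sup>2 - \<alpha> * z s * B s) / y s"
      using y_pos[of s] by simp
    then show "\<exists>D. ((\<lambda>s. 2 * B s / y s) has_real_derivative D) (at s) \<and> 0 < D"
      using b_deriv[of s] by blast
  qed (rule DERIV_continuous_on[OF has_field_derivative_at_within[OF b_deriv]])
  then show "Lambda \<alpha> p t $ 2 < Lambda \<alpha> p \<rho> $ 2"
    by (simp add: Lambda_eq vector_3)
qed

end

section \<open>The open rectangle inside the convex hull of its corners\<close>

lemma interior_of_bounding_box:
  assumes q: "q $ 3 = 0" "0 < q $ 1" "q $ 1 < a" "0 < q $ 2" "q $ 2 < b"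
  shows "q \<in> top_of_set XY_plane interior_of bounding_box a b"
proof -
  let ?U = "{q :: real^3. 0 < q $ 1 \<and> q $ 1 < a \<and> 0 < q $ 2 \<and> q $ 2 < b}"
  have "open ?U"
    by (intro open_Collect_conj open_Collect_less continuous_intros)
  then have "openin (top_of_set XY_plane) (XY_plane \<inter> ?U)"
    by (rule openin_open_Int)
  moreover have "XY_plane \<inter> ?U \<subseteq> bounding_box a b"
  proof
    fix v assume v: "v \<in> XY_plane \<inter> ?U"
    define s r where "s = v $ 1 / a" and "r = v $ 2 / b"
    have s: "0 \<le> s" "0 \<le> 1 - s" "s * a = v $ 1" and r: "0 \<le> r" "0 \<le> 1 - r" "r * b = v $ 2"
      using v by (auto simp: s_def r_def)
    have corner: "vector [0, 0, 0] \<in> bounding_box a b" "vector [0, b, 0] \<in> bounding_box a b"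
      "vector [a, 0, 0] \<in> bounding_box a b" "vector [a, b, 0] \<in> bounding_box a b"
      unfolding bounding_box_def by (auto intro: hull_inc)
    have conv: "convex (bounding_box a b)"
      unfolding bounding_box_def by (rule convex_convex_hull)
    \<comment> \<open>Bilinear interpolation of the four corners, written as nested convex
      combinations: \<open>r\<close> along the vertical sides, then \<open>s\<close> across.\<close>
    have "(1 - s) *\<^sub>R ((1 - r) *\<^sub>R vector [0, 0, 0] + r *\<^sub>R vector [0, b, 0])
        + s *\<^sub>R ((1 - r) *\<^sub>R vector [a, 0, 0] + r *\<^sub>R vector [a, b, 0]) \<in> bounding_box a b"
      by (intro convexD[OF conv] corner s r) simp_all
    also have "(1 - s) *\<^sub>R ((1 - r) *\<^sub>R vector [0, 0, 0] + r *\<^sub>R vector [0, b, 0])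
        + s *\<^sub>R ((1 - r) *\<^sub>R vector [a, 0, 0] + r *\<^sub>R vector [a, b, 0]) = v"
      using v s(3) r(3) by (simp add: vec_eq_iff forall_3 vector_3 XY_plane_def algebra_simps)
    finally show "v \<in> bounding_box a b" .
  qed
  moreover have "q \<in> XY_plane \<inter> ?U"
    using q by (simp add: XY_plane_def)
  ultimately show ?thesis
    unfolding interior_of_def by blast
qed

section \<open>Positivity of \<open>z\<close> during the first half period\<close>

context backward_flow
begin

text \<open>A zero of \<open>z\<close> at time \<open>s\<close> gives \<open>p s = p (- s)\<close> by reflection, hence a period \<open>2 s\<close>.\<close>

lemma z_nonzero:
  assumes "loop_period \<alpha> L P" "p 0 \<in> L" "0 < s" "s < P / 2"
  shows "z s \<noteq> 0"
proof
  assume "z s = 0"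
  then have ps: "p s = p (- s)"
    using reflection[of s] by (simp add: vec_eq_iff forall_3)
  obtain \<gamma> where \<gamma>: "integral_curve (Sigma_field \<alpha>) \<gamma>"
    and inj: "inj_on \<gamma> {0..<P}" and "\<gamma> ` {0..<P} = L"
    using assms(1) unfolding loop_period_def by blast
  then obtain r where r: "\<gamma> r = p 0"
    using \<open>p 0 \<in> L\<close> by force
  \<comment> \<open>By uniqueness \<open>p\<close> is the loop \<open>\<gamma>\<close> run backwards
    from parameter \<open>r\<close>.\<close>
  have "(\<lambda>t. \<gamma> (r + - 1 * t)) = p"
    using flow r
    by (intro Sigma_flow_unique[OF integral_curve_affine[OF \<gamma>], of _ _ _ 0]) simp_all
  then have p: "p t = \<gamma> (r - t)" for t
    by (auto dest: fun_cong[of _ _ t])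
  have "\<gamma> (r - s) = \<gamma> (2 * s + 1 * (r - s))"
    using ps p[of s] p[of "- s"] by (simp add: algebra_simps)
  moreover have "integral_curve (\<lambda>q. 1 *\<^sub>R Sigma_field \<alpha> q) \<gamma>"
    using \<gamma> by simp
  ultimately have "\<gamma> = (\<lambda>t. \<gamma> (2 * s + 1 * t))"
    by (intro Sigma_flow_unique[OF _ integral_curve_affine[OF \<gamma>], of 1 _ "r - s"])
  then have "\<gamma> 0 = \<gamma> (2 * s)"
    by (auto dest: fun_cong[of _ _ 0])
  \<comment> \<open>Since \<open>2 * s < P\<close>, both parameters lie in \<open>{0..<P}\<close>,
    where \<open>\<gamma>\<close> is injective.\<close>
  then have "0 = 2 * s"
    using assms(3,4) by (intro inj_onD[OF inj]) auto
  then show False using \<open>0 < s\<close> by simp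
qed

text \<open>\<open>z\<close> leaves 0 upwards because its derivative at 0 is positive; losing
  positivity later would force a zero by the intermediate value theorem, against
  \<open>z_nonzero\<close>.\<close>

lemma z_pos:
  assumes "loop_period \<alpha> L P" "p 0 \<in> L" "0 < t" "t < P / 2"
  shows "z t > 0"
proof (rule ccontr)
  assume "\<not> z t > 0"
  obtain d where d: "0 < d" "\<And>h. 0 < h \<Longrightarrow> h < d \<Longrightarrow> z 0 < z (0 + h)"
    using DERIV_pos_inc_right[OF z_deriv[of 0]] start_right by auto
  define h where "h = min t d / 2"
  have h: "0 < h" "h < d" "h \<le> t"
    using d(1) \<open>0 < t\<close> by (auto simp: h_def min_def)
  have "\<exists>s\<ge>h. s \<le> t \<and> z s = 0"
  proof (rule IVT2')
    show "continuous_on {h..t} z"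
      by (rule DERIV_continuous_on[OF has_field_derivative_at_within[OF z_deriv]])
  qed (use \<open>\<not> z t > 0\<close> d(2)[OF h(1,2)] h(3) start_plane in auto)
  then show False
    using z_nonzero[OF assms(1,2)] h(1) assms(4) by fastforce
qed

end

theorem theorem11:
  fixes \<alpha> P \<rho> :: real and L :: "(real^3) set" and p :: "real \<Rightarrow> real^3"
  assumes "0 < \<alpha>" and "\<alpha> \<le> 1"
    and "loop_level_set \<alpha> L" and "loop_period \<alpha> L P" and "\<rho> = P / 2"
    and "loop_start \<alpha> L (p 0)"
    and "integral_curve (\<lambda>q. - Sigma_field \<alpha> q) p"
  shows "\<forall>t\<in>{0<..<\<rho>}. Lambda \<alpha> p t \<in>
    top_of_set XY_plane interior_of bounding_box (Lambda \<alpha> p \<rho> $ 1) (Lambda \<alpha> p \<rho> $ 2)"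
proof
  have p0: "p 0 \<in> L" "p 0 $ 3 = 0" "sqrt (\<alpha> / (1 + \<alpha>)) < p 0 $ 1"
    using assms(6) unfolding loop_start_def by auto
  then have sphere: "norm (p 0) = 1" and pos: "p 0 $ 1 > 0" "p 0 $ 2 > 0"
    using assms(3) unfolding loop_level_set_def by auto
  have "(p 0 $ 1)\<^sup>2 + (p 0 $ 2)\<^sup>2 = (norm (p 0))\<^sup>2"
    unfolding power2_norm_eq_inner inner_vec_def sum_3 using p0(2) by (simp add: power2_eq_square)
  then have y2: "(p 0 $ 2)\<^sup>2 = 1 - (p 0 $ 1)\<^sup>2"
    using sphere by simp
  \<comment> \<open>On the unit circle \<open>x^2 + y^2 = 1\<close> the threshold
    \<open>x^2 > \<alpha> / (1 + \<alpha>)\<close> is equivalent to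
    \<open>\<alpha> y^2 < x^2\<close>, the condition \<open>start_right\<close>.\<close>
  have "\<alpha> / (1 + \<alpha>) < (p 0 $ 1)\<^sup>2"
    using p0(3) pos(1) real_less_rsqrt real_sqrt_less_iff[of "\<alpha> / (1 + \<alpha>)" "(p 0 $ 1)\<^sup>2"] by simp
  then have right: "\<alpha> * (p 0 $ 2)\<^sup>2 < (p 0 $ 1)\<^sup>2"
    using \<open>0 < \<alpha>\<close> unfolding y2 by (simp add: divide_less_eq algebra_simps)
  have cont: "isCont (\<lambda>t. p t $ i) t" for i t
    using assms(7) unfolding integral_curve_def has_vector_derivative_vec_iff
    by (blast intro: DERIV_isCont)
  obtain \<zeta> where \<zeta>: "\<And>t. (\<zeta> has_real_derivative p t $ 3) (at t)" "\<zeta> 0 = 0"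
    using antiderivative_exists[of "\<lambda>t. p t $ 3"] cont by blast
  obtain A where A: "\<And>t. (A has_real_derivative (p t $ 1)\<^sup>2) (at t)" "A 0 = 0"
    using antiderivative_exists[of "\<lambda>t. (p t $ 1)\<^sup>2", OF isCont_power[OF cont]] by blast
  obtain B where B: "\<And>t. (B has_real_derivative (p t $ 2)\<^sup>2) (at t)" "B 0 = 0"
    using antiderivative_exists[of "\<lambda>t. (p t $ 2)\<^sup>2", OF isCont_power[OF cont]] by blast
  interpret backward_flow \<alpha> p \<zeta> A B
    by unfold_locales (fact assms p0 sphere pos right \<zeta> A B)+
  fix t assume t: "t \<in> {0<..<\<rho>}"
  show "Lambda \<alpha> p t \<in>
      top_of_set XY_plane interior_of bounding_box (Lambda \<alpha> p \<rho> $ 1) (Lambda \<alpha> p \<rho> $ 2)"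
  proof (rule interior_of_bounding_box)
    show "Lambda \<alpha> p t $ 1 < Lambda \<alpha> p \<rho> $ 1" "Lambda \<alpha> p t $ 2 < Lambda \<alpha> p \<rho> $ 2"
      using z_pos[OF assms(4) p0(1)] t assms(5) by (auto intro!: Lambda_strict_mono)
  qed (use t A_pos B_pos x_pos y_pos in \<open>auto simp: Lambda_eq vector_3\<close>)
qed

end
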